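(* Let $\Omega\subset\mathbb{R}^N$ be a bounded domain and $k\in\{1,\dots,N\}$. The operator $\mathcal{I}^+_k(\cdot)+\mu\,\cdot$ satisfies the maximum principle in $\Omega$ for every real $\mu<\bar\mu^+_k$, and the operator $\mathcal{I}^-_k(\cdot)+\mu\,\cdot$ satisfies the maximum principle in $\Omega$ for every real $\mu<\bar\mu^-_k$.
   Context: Fix $s\in(0,1)$. $LSC$/$USC$ denote lower/upper semicontinuous functions; functions in $L^\infty(\mathbb{R}^N)$ are bounded measurable functions defined at every point. Set $\delta(u,x,y)=u(x+y)+u(x-y)-2u(x)$, let $C_s=C_{1,s}>0$ be the normalizing constant of the one-dimensional fractional Laplacian, and let $\mathcal{V}_k$ be the family of $k$-dimensional orthonormal sets in $\mathbb{R}^N$. The operators are $\mathcal{I}_k^+u(x)=\sup_{\{\xi_i\}\in\mathcal{V}_k}\sum_{i=1}^k\mathcal{I}_{\xi_i}u(x)$ and $\mathcal{I}_k^-u(x)=\inf_{\{\xi_i\}\in\mathcal{V}_k}\sum_{i=1}^k\mathcal{I}_{\xi_i}u(x)$, where $\mathcal{I}_\xi u(x)=C_s\int_0^{+\infty}\delta(u,x,\tau\xi)\tau^{-1-2s}\,d\tau$. Inequalities are in the viscosity sense: $u\in L^\infty(\mathbb{R}^N)\cap LSC(\Omega)$ (resp. $USC(\Omega)$) satisfies $\mathcal{I}_k^+u+\mu u\le0$ (resp. $\ge0$) in $\Omega$ if for every $x_0\in\Omega$, $\rho>0$ and $\varphi\in C^2(B_\rho(x_0))$ such that $x_0$ is a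 minimum (resp. maximum) point of $u-\varphi$ in $B_\rho(x_0)$, $$C_s\sup_{\{\xi_i\}\in\mathcal{V}_k}\sum_{i=1}^k\left(\int_0^\rho\frac{\delta(\varphi,x_0,\tau\xi_i)}{\tau^{1+2s}}\,d\tau+\int_\rho^{+\infty}\frac{\delta(u,x_0,\tau\xi_i)}{\tau^{1+2s}}\,d\tau\right)+\mu u(x_0)\le 0\quad(\text{resp. }\ge 0).$$ For $\mathcal{I}_k^-$ replace $\sup$ by $\inf$. An operator $\mathcal{J}$ satisfies the (weak) maximum principle in $\Omega$ if for every $u\in USC(\overline\Omega)\cap L^\infty(\mathbb{R}^N)$: $\mathcal{J}u\ge0$ in $\Omega$ and $u\le0$ in $\mathbb{R}^N\setminus\Omega$ imply $u\le0$ in $\Omega$. Define $$\bar\mu^\pm_k=\sup\left\{\mu\in\mathbb{R}:\ \exists v\in LSC(\Omega)\cap L^\infty(\mathbb{R}^N),\ \inf_\Omega v>0,\ v\ge0\text{ in }\mathbb{R}^N,\ \mathcal{I}^\pm_kv+\mu v\le0\text{ in }\Omega\right\}\in(-\infty,+\infty].$$ *)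

theory Defs
  imports "HOL-Analysis.Analysis"
begin

text \<open>
  The Euclidean space \<open>\<real>\<^sup>N\<close> is a type \<open>'a\<close> of class \<open>euclidean_space\<close>, with \<open>N = DIM('a)\<close>.
\<close>

section \<open>Function classes\<close>

text \<open>
  Bounded at every point, not just almost everywhere. Measurability is Borel measurability, so that
  the restrictions to lines, which are what the operators integrate, are measurable too.
\<close>
definition Linfty :: "('a::euclidean_space \<Rightarrow> real) set" where
  "Linfty = {u. u \<in> borel_measurable borel \<and> bounded (range u)}"

definition LSC :: "'a::topological_space set \<Rightarrow> ('a \<Rightarrow> real) set" where
  "LSC S = {u. \<forall>x\<in>S. \<forall>c<u x. \<forall>\<^sub>F y in at x within S. c < u y}"

definition USC :: "'a::topological_space set \<Rightarrow> ('a \<Rightarrow> real) set" where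
  "USC S = {u. \<forall>x\<in>S. \<forall>c>u x. \<forall>\<^sub>F y in at x within S. u y < c}"

text \<open>Intended for open \<open>S\<close>; \<open>D\<close> and \<open>D2\<close> are the first and second Frechet derivatives.\<close>
definition C2 :: "'a::euclidean_space set \<Rightarrow> ('a \<Rightarrow> real) set" where
  "C2 S = {\<phi>. \<exists>(D :: 'a \<Rightarrow> 'a \<Rightarrow>\<^sub>L real) (D2 :: 'a \<Rightarrow> 'a \<Rightarrow>\<^sub>L 'a \<Rightarrow>\<^sub>L real).
     (\<forall>x\<in>S. (\<phi> has_derivative blinfun_apply (D x)) (at x)) \<and>
     (\<forall>x\<in>S. (D has_derivative blinfun_apply (D2 x)) (at x)) \<and>
     continuous_on S D2}"

section \<open>The extremal operators\<close>

definition \<delta> :: "('a::real_vector \<Rightarrow> real) \<Rightarrow> 'a \<Rightarrow> 'a \<Rightarrow> real" where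
  "\<delta> u x y = u (x + y) + u (x - y) - 2 * u x"

text \<open>
  The constant \<open>C\<^sub>1\<^sub>,\<^sub>s\<close> of the one-dimensional fractional Laplacian, in closed form; it equals the
  reciprocal of the integral of \<open>(1 - cos t) / \<bar>t\<bar> powr (1 + 2 * s)\<close> over the real line.
\<close>
definition C\<^sub>s :: "real \<Rightarrow> real" where
  "C\<^sub>s s = 4 powr s * Gamma (1 / 2 + s) / (sqrt pi * \<bar>Gamma (- s)\<bar>)"

definition \<V> :: "nat \<Rightarrow> 'a::euclidean_space set set" where
  "\<V> k = {F. finite F \<and> card F = k \<and> pairwise orthogonal F \<and> (\<forall>\<xi>\<in>F. norm \<xi> = 1)}"

text \<open>
  Lebesgue integral with values in \<open>[-\<infinity>, \<infinity>]\<close>. It is meaningful when the positive or the negative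
  part has a finite integral. Infinite values have to be allowed, because a test function in
  \<open>C\<^sup>2(B\<^sub>\<rho>(x\<^sub>0))\<close> may blow up at the boundary of the ball. It can only do so with one sign: touching
  the bounded function \<open>u\<close> from below (above) bounds \<open>\<phi>\<close> from above (below) on the ball. Hence
  only one of the two infinities can occur in each viscosity inequality.
\<close>
definition ext_integral :: "real set \<Rightarrow> (real \<Rightarrow> real) \<Rightarrow> ereal" where
  "ext_integral A f =
     enn2ereal (\<integral>\<^sup>+\<tau>\<in>A. ennreal (f \<tau>) \<partial>lborel) - enn2ereal (\<integral>\<^sup>+\<tau>\<in>A. ennreal (- f \<tau>) \<partial>lborel)"

text \<open>
  In the following, the parameter \<open>ext\<close> is \<open>Sup\<close> for the operator \<open>\<I>\<^sub>k\<^sup>+\<close> and \<open>Inf\<close> for \<open>\<I>\<^sub>k\<^sup>-\<close>.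
\<close>
definition visc_op ::
  "(ereal set \<Rightarrow> ereal) \<Rightarrow> real \<Rightarrow> nat \<Rightarrow> real \<Rightarrow>
    ('a::euclidean_space \<Rightarrow> real) \<Rightarrow> ('a \<Rightarrow> real) \<Rightarrow> 'a \<Rightarrow> ereal" where
  "visc_op ext s k \<rho> \<phi> u x =
     ereal (C\<^sub>s s) * ext ((\<lambda>F. \<Sum>\<xi>\<in>F.
         ext_integral {0<..<\<rho>} (\<lambda>\<tau>. \<delta> \<phi> x (\<tau> *\<^sub>R \<xi>) / \<tau> powr (1 + 2 * s))
       + ext_integral {\<rho><..} (\<lambda>\<tau>. \<delta> u x (\<tau> *\<^sub>R \<xi>) / \<tau> powr (1 + 2 * s))) ` \<V> k)"

text \<open>\<open>\<I>\<^sub>k\<^sup>\<plusminus> u + \<mu> u \<le> 0\<close> in \<open>\<Omega>\<close> in the viscosity sense\<close>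
definition visc_supersol ::
  "(ereal set \<Rightarrow> ereal) \<Rightarrow> real \<Rightarrow> nat \<Rightarrow> real \<Rightarrow> 'a::euclidean_space set \<Rightarrow> ('a \<Rightarrow> real) \<Rightarrow> bool" where
  "visc_supersol ext s k \<mu> \<Omega> u \<longleftrightarrow> u \<in> Linfty \<inter> LSC \<Omega> \<and>
     (\<forall>x\<^sub>0\<in>\<Omega>. \<forall>\<rho>>0. \<forall>\<phi>\<in>C2 (ball x\<^sub>0 \<rho>).
        (\<forall>y\<in>ball x\<^sub>0 \<rho>. u x\<^sub>0 - \<phi> x\<^sub>0 \<le> u y - \<phi> y) \<longrightarrow>
        visc_op ext s k \<rho> \<phi> u x\<^sub>0 + ereal (\<mu> * u x\<^sub>0) \<le> 0)"

text \<open>\<open>\<I>\<^sub>k\<^sup>\<plusminus> u + \<mu> u \<ge> 0\<close> in \<open>\<Omega>\<close> in the viscosity sense\<close>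
definition visc_subsol ::
  "(ereal set \<Rightarrow> ereal) \<Rightarrow> real \<Rightarrow> nat \<Rightarrow> real \<Rightarrow> 'a::euclidean_space set \<Rightarrow> ('a \<Rightarrow> real) \<Rightarrow> bool" where
  "visc_subsol ext s k \<mu> \<Omega> u \<longleftrightarrow> u \<in> Linfty \<inter> USC \<Omega> \<and>
     (\<forall>x\<^sub>0\<in>\<Omega>. \<forall>\<rho>>0. \<forall>\<phi>\<in>C2 (ball x\<^sub>0 \<rho>).
        (\<forall>y\<in>ball x\<^sub>0 \<rho>. u y - \<phi> y \<le> u x\<^sub>0 - \<phi> x\<^sub>0) \<longrightarrow>
        visc_op ext s k \<rho> \<phi> u x\<^sub>0 + ereal (\<mu> * u x\<^sub>0) \<ge> 0)"

section \<open>The maximum principle and the generalized principal eigenvalues\<close>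

definition maximum_principle ::
  "(ereal set \<Rightarrow> ereal) \<Rightarrow> real \<Rightarrow> nat \<Rightarrow> real \<Rightarrow> 'a::euclidean_space set \<Rightarrow> bool" where
  "maximum_principle ext s k \<mu> \<Omega> \<longleftrightarrow>
     (\<forall>u \<in> USC (closure \<Omega>) \<inter> Linfty.
        visc_subsol ext s k \<mu> \<Omega> u \<and> (\<forall>x\<in>- \<Omega>. u x \<le> 0) \<longrightarrow> (\<forall>x\<in>\<Omega>. u x \<le> 0))"

definition mu_bar ::
  "(ereal set \<Rightarrow> ereal) \<Rightarrow> real \<Rightarrow> nat \<Rightarrow> 'a::euclidean_space set \<Rightarrow> ereal" where
  "mu_bar ext s k \<Omega> = Sup {ereal \<mu> | \<mu>. \<exists>v \<in> LSC \<Omega> \<inter> Linfty.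
     (INF x\<in>\<Omega>. v x) > 0 \<and> (\<forall>x. v x \<ge> 0) \<and> visc_supersol ext s k \<mu> \<Omega> v}"

end

theory Submission
  imports Defs
begin

text \<open>
  Suppose that a subsolution \<open>u\<close> for \<open>\<mu>\<close> is positive somewhere, let \<open>v\<close> be an admissible
  supersolution for some \<open>\<nu> > \<mu>\<close>, and let \<open>T\<close> be the supremum of \<open>u / v\<close> over \<open>\<Omega>\<close>.
  For \<open>t < T\<close> close to \<open>T\<close> the doubled function \<open>u x - t * v y - \<alpha> * \<bar>x - y\<bar>\<^sup>2\<close> attains a positive
  global maximum at some \<open>x, y \<in> \<Omega>\<close> if \<open>\<alpha>\<close> is large. Translating both points by the same vector
  does not change the penalty, so maximality gives \<open>\<delta> u x z \<le> t * \<delta> v y z\<close> for every \<open>z\<close>, direction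
  by direction. This carries over to both extremal operators, and the contribution of the quadratic
  test functions vanishes as \<open>\<rho> \<rightarrow> 0\<close>, which leaves \<open>\<nu> * t * v y \<le> \<mu> * u x\<close>. As \<open>u x / v y\<close>
  is squeezed between \<open>t\<close> and a number slightly above \<open>T\<close>, this contradicts \<open>\<mu> < \<nu>\<close>.
\<close>

section \<open>Integrals and constants\<close>

lemma C\<^sub>s_nonneg: "0 < s \<Longrightarrow> C\<^sub>s s \<ge> 0"
  unfolding C\<^sub>s_def by (intro divide_nonneg_nonneg mult_nonneg_nonneg) auto

lemma ext_integral_cong:
  assumes "\<And>\<tau>. \<tau> \<in> A \<Longrightarrow> f \<tau> = g \<tau>"
  shows "ext_integral A f = ext_integral A g"
proof -
  have "(\<integral>\<^sup>+\<tau>\<in>A. ennreal (f \<tau>) \<partial>lborel) = (\<integral>\<^sup>+\<tau>\<in>A. ennreal (g \<tau>) \<partial>lborel)"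
    "(\<integral>\<^sup>+\<tau>\<in>A. ennreal (- f \<tau>) \<partial>lborel) = (\<integral>\<^sup>+\<tau>\<in>A. ennreal (- g \<tau>) \<partial>lborel)"
    using assms by (auto intro!: nn_integral_cong split: split_indicator)
  then show ?thesis by (simp add: ext_integral_def)
qed

text \<open>Both signs are needed because the test functions for \<open>u\<close> and
  \<open>v\<close> have the coefficients \<open>\<alpha>\<close> and \<open>- (\<alpha> / t)\<close>
  of opposite sign.\<close>

lemma ext_integral_nonneg:
  assumes "\<And>\<tau>. \<tau> \<in> A \<Longrightarrow> 0 \<le> f \<tau>" "(f has_integral I) A"
  shows "ext_integral A f = ereal I" "ext_integral A (\<lambda>\<tau>. - f \<tau>) = ereal (- I)"
proof -
  have I: "0 \<le> I"
    using has_integral_nonneg assms by blast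
  have "(\<integral>\<^sup>+\<tau>\<in>A. ennreal (f \<tau>) \<partial>lborel) = ennreal I"
    using nn_integral_has_integral_lebesgue'[OF assms] .
  moreover have "(\<integral>\<^sup>+\<tau>\<in>A. ennreal (- f \<tau>) \<partial>lborel) = (\<integral>\<^sup>+(\<tau>::real). 0 \<partial>lborel)"
    using assms(1) by (intro nn_integral_cong) (auto split: split_indicator simp: ennreal_neg)
  ultimately show "ext_integral A f = ereal I" "ext_integral A (\<lambda>\<tau>. - f \<tau>) = ereal (- I)"
    using I by (simp_all add: ext_integral_def zero_ennreal.rep_eq)
qed

text \<open>The positive parts and the negative parts are compared separately in [0, \<infinity>].
  The second comparison is reversed, so the differences stay ordered even where an integral is
  infinite.\<close>

lemma ext_integral_mono_cmult:
  assumes [measurable]: "f \<in> borel_measurable borel" "g \<in> borel_measurable borel" "A \<in> sets borel"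
    and t: "0 < t" and le: "\<And>\<tau>. \<tau> \<in> A \<Longrightarrow> f \<tau> \<le> t * g \<tau>"
  shows "ext_integral A f \<le> ereal t * ext_integral A g"
proof -
  let ?p = "\<integral>\<^sup>+\<tau>\<in>A. ennreal (g \<tau>) \<partial>lborel" and ?n = "\<integral>\<^sup>+\<tau>\<in>A. ennreal (- g \<tau>) \<partial>lborel"
  have "(\<integral>\<^sup>+\<tau>\<in>A. ennreal (f \<tau>) \<partial>lborel) \<le> (\<integral>\<^sup>+\<tau>. ennreal t * (ennreal (g \<tau>) * indicator A \<tau>) \<partial>lborel)"
    using le t by (intro nn_integral_mono) (auto split: split_indicator simp: ennreal_mult'[symmetric] intro!: ennreal_leI)
  also have "\<dots> = ennreal t * ?p"
    by (rule nn_integral_cmult) measurable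
  finally have p: "enn2ereal (\<integral>\<^sup>+\<tau>\<in>A. ennreal (f \<tau>) \<partial>lborel) \<le> ereal t * enn2ereal ?p"
    using t by (simp add: less_eq_ennreal.rep_eq times_ennreal.rep_eq)
  have "ennreal t * ?n = (\<integral>\<^sup>+\<tau>. ennreal t * (ennreal (- g \<tau>) * indicator A \<tau>) \<partial>lborel)"
    by (rule nn_integral_cmult[symmetric]) measurable
  also have "\<dots> \<le> (\<integral>\<^sup>+\<tau>\<in>A. ennreal (- f \<tau>) \<partial>lborel)"
    using le t by (intro nn_integral_mono) (auto split: split_indicator simp: ennreal_mult'[symmetric] intro!: ennreal_leI)
  finally have n: "ereal t * enn2ereal ?n \<le> enn2ereal (\<integral>\<^sup>+\<tau>\<in>A. ennreal (- f \<tau>) \<partial>lborel)"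
    using t by (simp add: less_eq_ennreal.rep_eq times_ennreal.rep_eq)
  have "ereal t * (enn2ereal ?p - enn2ereal ?n) = ereal t * enn2ereal ?p - ereal t * enn2ereal ?n"
    using ereal_pos_distrib[of "ereal t" "enn2ereal ?p" "- enn2ereal ?n"] t
    by (simp add: minus_ereal_def)
  with ereal_minus_mono[OF p n] show ?thesis by (simp add: ext_integral_def)
qed

section \<open>Quadratic test functions\<close>

lemma \<delta>_quadratic:
  "\<delta> (\<lambda>z. \<beta> * (norm (z - b))\<^sup>2) x y = 2 * \<beta> * (norm (y::'a::real_inner))\<^sup>2"
  by (simp add: \<delta>_def power2_norm_eq_inner algebra_simps inner_commute)

text \<open>The centre \<open>b\<close> and the point \<open>x\<close> drop out of
  \<open>\<delta>\<close>, which leaves the power \<open>1 - 2 * s\<close>. It exceeds -1 because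
  \<open>s < 1\<close>, hence is integrable at 0.\<close>

lemma ext_integral_quadratic:
  assumes "s < 1" "0 < \<rho>" "norm (\<xi>::'a::euclidean_space) = 1"
  shows "ext_integral {0<..<\<rho>} (\<lambda>\<tau>. \<delta> (\<lambda>z. \<beta> * (norm (z - b))\<^sup>2) x (\<tau> *\<^sub>R \<xi>) / \<tau> powr (1 + 2 * s))
    = ereal (\<beta> * \<rho> powr (2 - 2 * s) / (1 - s))"
proof -
  have eq: "\<delta> (\<lambda>z. \<beta> * (norm (z - b))\<^sup>2) x (\<tau> *\<^sub>R \<xi>) / \<tau> powr (1 + 2 * s) = 2 * \<beta> * \<tau> powr (1 - 2 * s)"
    if "\<tau> \<in> {0<..<\<rho>}" for \<tau>
  proof -
    have "\<tau>\<^sup>2 = \<tau> powr (1 - 2 * s) * \<tau> powr (1 + 2 * s)"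
      using that by (simp add: powr_add[symmetric])
    then show ?thesis
      using that assms by (simp add: \<delta>_quadratic field_simps)
  qed
  have I: "((\<lambda>\<tau>. 2 * \<gamma> * \<tau> powr (1 - 2 * s)) has_integral (\<gamma> * \<rho> powr (2 - 2 * s) / (1 - s))) {0<..<\<rho>}" for \<gamma>
  proof -
    have "((\<lambda>\<tau>. 2 * \<gamma> * \<tau> powr (1 - 2 * s)) has_integral
        2 * \<gamma> * (\<rho> powr (1 - 2 * s + 1) / (1 - 2 * s + 1))) {0..\<rho>}"
      using assms by (intro has_integral_mult_right has_integral_powr_from_0) auto
    moreover have "2 * \<gamma> * (\<rho> powr (1 - 2 * s + 1) / (1 - 2 * s + 1)) = \<gamma> * \<rho> powr (2 - 2 * s) / (1 - s)"
      using assms by (simp add: field_simps)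
    ultimately show ?thesis
      by (simp add: has_integral_Icc_iff_Ioo)
  qed
  have "ext_integral {0<..<\<rho>} (\<lambda>\<tau>. 2 * \<beta> * \<tau> powr (1 - 2 * s)) = ereal (\<beta> * \<rho> powr (2 - 2 * s) / (1 - s))"
  proof (cases "\<beta> \<ge> 0")
    case True
    then show ?thesis using ext_integral_nonneg(1)[OF _ I] by simp
  next
    case False
    then show ?thesis using ext_integral_nonneg(2)[OF _ I[of "- \<beta>"]] by (simp add: mult_nonpos_nonneg)
  qed
  moreover have "ext_integral {0<..<\<rho>} (\<lambda>\<tau>. \<delta> (\<lambda>z. \<beta> * (norm (z - b))\<^sup>2) x (\<tau> *\<^sub>R \<xi>) / \<tau> powr (1 + 2 * s))
      = ext_integral {0<..<\<rho>} (\<lambda>\<tau>. 2 * \<beta> * \<tau> powr (1 - 2 * s))"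
    by (rule ext_integral_cong) (rule eq)
  ultimately show ?thesis by simp
qed

lemma C2_quadratic: "(\<lambda>z. \<beta> * (norm (z - b))\<^sup>2) \<in> C2 (S :: 'a::euclidean_space set)"
proof -
  have 1: "((\<lambda>z. \<beta> * (norm (z - b))\<^sup>2) has_derivative
      blinfun_apply ((2 * \<beta>) *\<^sub>R blinfun_inner_left (x - b))) (at x)" for x
    unfolding power2_norm_eq_inner
    by (auto intro!: derivative_eq_intros simp: fun_eq_iff inner_commute blinfun.scaleR_left)
  let ?L = "Blinfun (\<lambda>h::'a. (2 * \<beta>) *\<^sub>R (blinfun_inner_left h :: 'a \<Rightarrow>\<^sub>L real))"
  have bl: "bounded_linear (\<lambda>h::'a. (2 * \<beta>) *\<^sub>R (blinfun_inner_left h :: 'a \<Rightarrow>\<^sub>L real))"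
    by (intro bounded_linear_intros)
  have 2: "((\<lambda>x. (2 * \<beta>) *\<^sub>R blinfun_inner_left (x - b)) has_derivative blinfun_apply ?L) (at x)" for x
    unfolding bounded_linear_Blinfun_apply[OF bl]
    by (auto intro!: derivative_eq_intros bounded_linear.has_derivative[OF bounded_linear_blinfun_inner_left])
  have "continuous_on S (\<lambda>_. ?L)" by simp
  with 1 2 show ?thesis unfolding C2_def
    by (intro CollectI exI[of _ "\<lambda>x. (2 * \<beta>) *\<^sub>R blinfun_inner_left (x - b)"] exI[of _ "\<lambda>_. ?L"]) auto
qed

section \<open>Comparison of the operators at touching points\<close>

text \<open>
  The affine form \<open>c + t * b\<close> makes it unnecessary to know that any of the integrals is finite:
  only the explicit quadratic contributions are ever moved across an inequality.
\<close>
lemma ereal_affine_le_iff: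
  assumes "0 < t"
  shows "a \<le> ereal c + ereal t * b \<longleftrightarrow> ereal (1 / t) * (a - ereal c) \<le> b"
  using assms by (cases a; cases b) (auto simp: field_simps)

lemma sum_ereal_affine_le:
  assumes "finite F" "0 \<le> t" "\<And>\<xi>. \<xi> \<in> F \<Longrightarrow> a \<xi> \<le> ereal c + ereal t * b \<xi>"
  shows "(\<Sum>\<xi>\<in>F. a \<xi>) \<le> ereal (real (card F) * c) + ereal t * (\<Sum>\<xi>\<in>F. b \<xi>)"
  using assms(1,3)
proof (induction F)
  case empty
  then show ?case by simp
next
  case (insert \<xi> F)
  have "(\<Sum>\<xi>\<in>insert \<xi> F. a \<xi>) \<le> (ereal c + ereal t * b \<xi>) + (ereal (real (card F) * c) + ereal t * (\<Sum>\<xi>\<in>F. b \<xi>))"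
    using insert by (simp add: add_mono)
  also have "\<dots> = (ereal c + ereal (real (card F) * c)) + (ereal t * b \<xi> + ereal t * (\<Sum>\<xi>\<in>F. b \<xi>))"
    by (simp only: ac_simps)
  also have "\<dots> = ereal (real (card (insert \<xi> F)) * c) + ereal t * (\<Sum>\<xi>\<in>insert \<xi> F. b \<xi>)"
    using insert assms(2) by (simp add: ereal_pos_distrib algebra_simps)
  finally show ?case .
qed

text \<open>The map from \<open>b\<close> to \<open>c + t * b\<close> is an increasing bijection of
  [-\<infinity>, \<infinity>]. For \<open>Sup\<close> it is enough that it is monotone; for
  \<open>Inf\<close> it is inverted, so that the bound becomes a lower bound of \<open>g\<close>
  alone.\<close>

lemma ext_ereal_affine_le:
  assumes ext: "ext = Sup \<or> ext = Inf" and t: "0 < t"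
    and le: "\<And>F. F \<in> V \<Longrightarrow> f F \<le> ereal c + ereal t * g F"
  shows "ext (f ` V) \<le> ereal c + ereal t * ext (g ` V)"
  using ext
proof
  assume "ext = Sup"
  moreover have "f F \<le> ereal c + ereal t * Sup (g ` V)" if "F \<in> V" for F
    using le[OF that] t that
    by (intro order_trans[OF le[OF that]] add_left_mono ereal_mult_left_mono SUP_upper) auto
  ultimately show ?thesis by (auto intro: SUP_least)
next
  assume "ext = Inf"
  moreover have "ereal (1 / t) * (Inf (f ` V) - ereal c) \<le> g F" if "F \<in> V" for F
    unfolding ereal_affine_le_iff[OF t, symmetric]
    using le[OF that] that by (meson INF_lower order_trans)
  then have "ereal (1 / t) * (Inf (f ` V) - ereal c) \<le> Inf (g ` V)"
    by (auto intro: INF_greatest)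
  ultimately show ?thesis by (simp add: ereal_affine_le_iff[OF t])
qed

lemma borel_measurable_line_kernel:
  assumes "u \<in> Linfty"
  shows "(\<lambda>\<tau>. \<delta> u x (\<tau> *\<^sub>R \<xi>) / \<tau> powr (1 + 2 * s)) \<in> borel_measurable borel"
proof -
  have [measurable]: "u \<in> borel_measurable borel"
    using assms by (simp add: Linfty_def)
  show ?thesis unfolding \<delta>_def by measurable
qed

text \<open>The two quadratics are the penalty with one of its points frozen. Inside the ball the
  integrals are explicit; outside it they are compared direction by direction through
  \<open>le\<close>.\<close>

lemma visc_op_le:
  fixes x y :: "'a::euclidean_space"
  assumes s: "0 < s" "s < 1" and ext: "ext = Sup \<or> ext = Inf" and t: "0 < t" and \<rho>: "0 < \<rho>"
    and u: "u \<in> Linfty" and v: "v \<in> Linfty"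
    and le: "\<And>z. \<delta> u x z \<le> t * \<delta> v y z"
  shows "visc_op ext s k \<rho> (\<lambda>z. \<alpha> * (norm (z - y))\<^sup>2) u x
    \<le> ereal (C\<^sub>s s * (real k * (2 * \<alpha> / (1 - s) * \<rho> powr (2 - 2 * s))))
      + ereal t * visc_op ext s k \<rho> (\<lambda>z. (- (\<alpha> / t)) * (norm (z - x))\<^sup>2) v y"
proof -
  let ?p = "\<alpha> * \<rho> powr (2 - 2 * s) / (1 - s)"
  \<comment> \<open>This is twice \<open>?p\<close>: in each direction the test function of
    \<open>u\<close> contributes \<open>?p\<close>, and \<open>t\<close> times that of
    \<open>v\<close> contributes \<open>- ?p\<close>.\<close>
  let ?c = "2 * \<alpha> / (1 - s) * \<rho> powr (2 - 2 * s)"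
  let ?Eu = "\<lambda>\<xi>. ext_integral {\<rho><..} (\<lambda>\<tau>. \<delta> u x (\<tau> *\<^sub>R \<xi>) / \<tau> powr (1 + 2 * s))"
  let ?Ev = "\<lambda>\<xi>. ext_integral {\<rho><..} (\<lambda>\<tau>. \<delta> v y (\<tau> *\<^sub>R \<xi>) / \<tau> powr (1 + 2 * s))"
  let ?a = "\<lambda>\<xi>. ext_integral {0<..<\<rho>} (\<lambda>\<tau>. \<delta> (\<lambda>z. \<alpha> * (norm (z - y))\<^sup>2) x (\<tau> *\<^sub>R \<xi>) / \<tau> powr (1 + 2 * s)) + ?Eu \<xi>"
  let ?b = "\<lambda>\<xi>. ext_integral {0<..<\<rho>} (\<lambda>\<tau>. \<delta> (\<lambda>z. (- (\<alpha> / t)) * (norm (z - x))\<^sup>2) y (\<tau> *\<^sub>R \<xi>) / \<tau> powr (1 + 2 * s)) + ?Ev \<xi>"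
  have E: "?Eu \<xi> \<le> ereal t * ?Ev \<xi>" for \<xi>
  proof (rule ext_integral_mono_cmult[OF _ _ _ t])
    fix \<tau> assume "\<tau> \<in> {\<rho><..}"
    then show "\<delta> u x (\<tau> *\<^sub>R \<xi>) / \<tau> powr (1 + 2 * s) \<le> t * (\<delta> v y (\<tau> *\<^sub>R \<xi>) / \<tau> powr (1 + 2 * s))"
      using divide_right_mono[OF le[of "\<tau> *\<^sub>R \<xi>"], of "\<tau> powr (1 + 2 * s)"] by simp
  qed (use u v in \<open>auto intro: borel_measurable_line_kernel\<close>)
  have ab: "?a \<xi> \<le> ereal ?c + ereal t * ?b \<xi>" if "norm \<xi> = 1" for \<xi>
  proof -
    have a: "?a \<xi> = ereal ?p + ?Eu \<xi>"
      by (simp only: ext_integral_quadratic[OF s(2) \<rho> that])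
    have b: "?b \<xi> = ereal (- (?p / t)) + ?Ev \<xi>"
      by (simp only: ext_integral_quadratic[OF s(2) \<rho> that]) (simp add: mult.commute)
    have "ereal ?c + ereal t * ?b \<xi> = ereal ?c + (ereal t * ereal (- (?p / t)) + ereal t * ?Ev \<xi>)"
      unfolding b using t by (subst ereal_pos_distrib) auto
    also have "\<dots> = (ereal ?c + ereal t * ereal (- (?p / t))) + ereal t * ?Ev \<xi>"
      by (simp only: add.assoc)
    also have "ereal ?c + ereal t * ereal (- (?p / t)) = ereal ?p"
      using t by simp
    finally show ?thesis
      unfolding a using E[of \<xi>] by (simp only: add_left_mono)
  qed
  let ?f = "\<lambda>F. \<Sum>\<xi>\<in>F. ?a \<xi>" and ?g = "\<lambda>F. \<Sum>\<xi>\<in>F. ?b \<xi>"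
  have fg: "?f F \<le> ereal (real k * ?c) + ereal t * ?g F" if "F \<in> \<V> k" for F :: "'a set"
    using sum_ereal_affine_le[of F t ?a ?c ?b] ab t that by (auto simp: \<V>_def)
  have "ext (?f ` \<V> k) \<le> ereal (real k * ?c) + ereal t * ext (?g ` \<V> k)"
    by (rule ext_ereal_affine_le[OF ext t fg])
  then have "ereal (C\<^sub>s s) * ext (?f ` \<V> k)
      \<le> ereal (C\<^sub>s s) * (ereal (real k * ?c) + ereal t * ext (?g ` \<V> k))"
    using C\<^sub>s_nonneg[OF s(1)] by (intro ereal_mult_left_mono) auto
  also have "\<dots> = ereal (C\<^sub>s s * (real k * ?c)) + ereal t * (ereal (C\<^sub>s s) * ext (?g ` \<V> k))"
    using C\<^sub>s_nonneg[OF s(1)] by (simp add: ereal_pos_distrib mult.left_commute)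
  finally show ?thesis unfolding visc_op_def .
qed

section \<open>Viscosity inequalities at a maximum of the doubled function\<close>

lemma visc_subsolD:
  assumes "visc_subsol ext s k \<mu> \<Omega> u" "x \<in> \<Omega>" "0 < \<rho>" "\<phi> \<in> C2 (ball x \<rho>)"
    and "\<And>z. u z - \<phi> z \<le> u x - \<phi> x"
  shows "0 \<le> visc_op ext s k \<rho> \<phi> u x + ereal (\<mu> * u x)"
  using assms unfolding visc_subsol_def by simp

lemma visc_supersolD:
  assumes "visc_supersol ext s k \<mu> \<Omega> u" "x \<in> \<Omega>" "0 < \<rho>" "\<phi> \<in> C2 (ball x \<rho>)"
    and "\<And>z. u x - \<phi> x \<le> u z - \<phi> z"
  shows "visc_op ext s k \<rho> \<phi> u x + ereal (\<mu> * u x) \<le> 0"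
  using assms unfolding visc_supersol_def by simp

lemma touching_inequality:
  fixes x y :: "'a::euclidean_space"
  assumes s: "0 < s" "s < 1" and ext: "ext = Sup \<or> ext = Inf" and t: "0 < t"
    and u: "visc_subsol ext s k \<mu> \<Omega> u" and v: "visc_supersol ext s k \<nu> \<Omega> v"
    and x: "x \<in> \<Omega>" and y: "y \<in> \<Omega>"
    and max: "\<And>a b. u a - t * v b - \<alpha> * (norm (a - b))\<^sup>2 \<le> u x - t * v y - \<alpha> * (norm (x - y))\<^sup>2"
  shows "\<nu> * (t * v y) \<le> \<mu> * u x"
proof -
  let ?c = "\<lambda>\<rho>. C\<^sub>s s * (real k * (2 * \<alpha> / (1 - s) * \<rho> powr (2 - 2 * s)))"
  \<comment> \<open>Moving both points by \<open>z\<close> or by \<open>- z\<close> leaves the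
    penalty unchanged; the two resulting inequalities add up to one between second
    differences.\<close>
  have \<delta>_le: "\<delta> u x z \<le> t * \<delta> v y z" for z
    using max[of "x + z" "y + z"] max[of "x - z" "y - z"] by (simp add: \<delta>_def algebra_simps)
  have le: "\<nu> * (t * v y) \<le> \<mu> * u x + ?c \<rho>" if \<rho>: "0 < \<rho>" for \<rho>
  proof -
    let ?\<phi> = "\<lambda>z. \<alpha> * (norm (z - y))\<^sup>2" and ?\<psi> = "\<lambda>z. (- (\<alpha> / t)) * (norm (z - x))\<^sup>2"
    let ?U = "visc_op ext s k \<rho> ?\<phi> u x" and ?W = "visc_op ext s k \<rho> ?\<psi> v y"
    \<comment> \<open>With the second point frozen at \<open>y\<close>, the maximum says that
      \<open>?\<phi>\<close> touches \<open>u\<close> from above at \<open>x\<close>, up to a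
      constant.\<close>
    have U: "0 \<le> ?U + ereal (\<mu> * u x)"
    proof (rule visc_subsolD[OF u x \<rho> C2_quadratic])
      show "u z - ?\<phi> z \<le> u x - ?\<phi> x" for z
        using max[of z y] by simp
    qed
    \<comment> \<open>With the first point frozen at \<open>x\<close>, dividing by \<open>t\<close>
      shows that \<open>?\<psi>\<close> touches \<open>v\<close> from below at \<open>y\<close>, up
      to a constant.\<close>
    have W: "?W + ereal (\<nu> * v y) \<le> 0"
    proof (rule visc_supersolD[OF v y \<rho> C2_quadratic])
      fix z
      have "t * (w - (- (\<alpha> / t)) * q) = t * w + \<alpha> * q" for w q
        using t by (simp add: field_simps)
      then have "t * (v y - ?\<psi> y) \<le> t * (v z - ?\<psi> z)"
        using max[of x z] by (simp add: norm_minus_commute)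
      with t show "v y - ?\<psi> y \<le> v z - ?\<psi> z" by (simp only: mult_le_cancel_left_pos)
    qed
    have "?W \<le> ereal (- (\<nu> * v y))"
      using W by (cases ?W) auto
    then have "ereal t * ?W \<le> ereal t * ereal (- (\<nu> * v y))"
      using t by (intro ereal_mult_left_mono) auto
    moreover have "?U \<le> ereal (?c \<rho>) + ereal t * ?W"
      using u v by (intro visc_op_le[OF s ext t \<rho> _ _ \<delta>_le]) (simp_all add: visc_subsol_def visc_supersol_def)
    ultimately have "?U \<le> ereal (?c \<rho>) + ereal t * ereal (- (\<nu> * v y))"
      by (meson add_left_mono order_trans)
    also have "\<dots> = ereal (?c \<rho> - \<nu> * (t * v y))"
      by (simp add: mult.left_commute)
    finally have "?U \<le> ereal (?c \<rho> - \<nu> * (t * v y))" .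
    then show ?thesis
      using U by (cases ?U) auto
  qed
  \<comment> \<open>The exponent is positive as \<open>s < 1\<close>, so the error
    \<open>?c \<rho>\<close> vanishes in the limit while \<open>\<alpha>\<close>, \<open>x\<close>
    and \<open>y\<close> stay fixed.\<close>
  have "((\<lambda>\<rho>. \<rho> powr (2 - 2 * s)) \<longlongrightarrow> 0 powr (2 - 2 * s)) (at_right 0)"
    using s by (intro tendsto_powr' tendsto_ident_at tendsto_const) (auto simp: eventually_at_filter)
  then have "((\<lambda>\<rho>. \<rho> powr (2 - 2 * s)) \<longlongrightarrow> 0) (at_right 0)" by simp
  then have "((\<lambda>\<rho>. \<mu> * u x + ?c \<rho>) \<longlongrightarrow> \<mu> * u x + C\<^sub>s s * (real k * (2 * \<alpha> / (1 - s) * 0))) (at_right 0)"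
    by (intro tendsto_intros)
  moreover have "\<forall>\<^sub>F \<rho> in at_right 0. \<nu> * (t * v y) \<le> \<mu> * u x + ?c \<rho>"
    using le by (auto simp: eventually_at_filter)
  ultimately have "\<nu> * (t * v y) \<le> \<mu> * u x + C\<^sub>s s * (real k * (2 * \<alpha> / (1 - s) * 0))"
    by (rule tendsto_lowerbound) simp
  then show ?thesis by simp
qed

section \<open>Semicontinuity and the doubling of variables\<close>

text \<open>Without a maximum, the open sets on which \<open>f\<close> stays below one of its own
  values cover \<open>S\<close>. In a finite subcover, the point with the largest of these values
  lies in some member, so its value is below another of them.\<close>

lemma upper_semicontinuous_attains_sup:
  fixes f :: "'a::topological_space \<Rightarrow> real"
  assumes "compact S" "S \<noteq> {}"
    and usc: "\<And>x c. x \<in> S \<Longrightarrow> f x < c \<Longrightarrow> \<exists>U. open U \<and> x \<in> U \<and> (\<forall>y\<in>U \<inter> S. f y < c)"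
  shows "\<exists>x\<in>S. \<forall>y\<in>S. f y \<le> f x"
proof (rule ccontr)
  assume "\<not> ?thesis"
  then have no_max: "\<exists>y\<in>S. f x < f y" if "x \<in> S" for x
    using that by (auto simp: not_le)
  define \<C> where "\<C> = {U. open U \<and> (\<exists>y\<in>S. \<forall>z\<in>U \<inter> S. f z < f y)}"
  have cover: "S \<subseteq> \<Union>\<C>"
  proof
    fix x assume x: "x \<in> S"
    then obtain y where y: "y \<in> S" "f x < f y" using no_max by blast
    obtain U where "open U" "x \<in> U" "\<forall>z\<in>U \<inter> S. f z < f y"
      using usc[OF x y(2)] by blast
    then show "x \<in> \<Union>\<C>" using y(1) by (auto simp: \<C>_def)
  qed
  have "\<And>U. U \<in> \<C> \<Longrightarrow> open U" by (simp add: \<C>_def)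
  then obtain \<D> where \<D>: "\<D> \<subseteq> \<C>" "finite \<D>" "S \<subseteq> \<Union>\<D>"
    using compactE[OF assms(1) cover] by metis
  have "\<forall>U\<in>\<D>. \<exists>y. y \<in> S \<and> (\<forall>z\<in>U \<inter> S. f z < f y)"
  proof
    fix U assume "U \<in> \<D>"
    with \<D>(1) have "U \<in> \<C>" by blast
    then show "\<exists>y. y \<in> S \<and> (\<forall>z\<in>U \<inter> S. f z < f y)" unfolding \<C>_def by blast
  qed
  then obtain Y where Y: "\<And>U. U \<in> \<D> \<Longrightarrow> Y U \<in> S" "\<And>U z. U \<in> \<D> \<Longrightarrow> z \<in> U \<inter> S \<Longrightarrow> f z < f (Y U)"
    by metis
  have "\<D> \<noteq> {}" using \<D>(3) assms(2) by auto
  then have "Max ((\<lambda>U. f (Y U)) ` \<D>) \<in> (\<lambda>U. f (Y U)) ` \<D>"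
    using \<D>(2) by (intro Max_in) auto
  then obtain U where U: "U \<in> \<D>" "f (Y U) = Max ((\<lambda>U. f (Y U)) ` \<D>)"
    by auto
  obtain W where W: "W \<in> \<D>" "Y U \<in> W"
    using Y(1)[OF U(1)] \<D>(3) by auto
  have "f (Y U) < f (Y W)"
    using Y U(1) W by blast
  moreover have "f (Y W) \<le> f (Y U)"
    unfolding U(2) using \<D>(2) W(1) by (intro Max_ge) auto
  ultimately show False by simp
qed

text \<open>The filter in \<open>USC\<close> leaves out \<open>x\<close> itself; the assumption on
  \<open>u x\<close> fills this gap.\<close>

lemma USC_open_nbhd:
  assumes "u \<in> USC S" "x \<in> S" "u x < c"
  obtains U where "open U" "x \<in> U" "\<forall>y\<in>U \<inter> S. u y < c"
proof -
  have "\<forall>\<^sub>F y in at x within S. u y < c"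
    using assms by (simp add: USC_def)
  then obtain U where "open U" "x \<in> U" "\<forall>y\<in>U. y \<noteq> x \<longrightarrow> y \<in> S \<longrightarrow> u y < c"
    unfolding eventually_at_topological by blast
  moreover from this(3) have "\<forall>y\<in>U \<inter> S. u y < c" using assms(3) by auto
  ultimately show ?thesis using that by blast
qed

lemma LSC_open_nbhd:
  assumes "v \<in> LSC S" "x \<in> S" "c < v x"
  obtains U where "open U" "x \<in> U" "\<forall>y\<in>U \<inter> S. c < v y"
proof -
  have "\<forall>\<^sub>F y in at x within S. c < v y"
    using assms by (simp add: LSC_def)
  then obtain U where "open U" "x \<in> U" "\<forall>y\<in>U. y \<noteq> x \<longrightarrow> y \<in> S \<longrightarrow> c < v y"
    unfolding eventually_at_topological by blast
  moreover from this(3) have "\<forall>y\<in>U \<inter> S. c < v y" using assms(3) by auto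
  ultimately show ?thesis using that by blast
qed

lemma doubled_function_attains_sup:
  fixes u v :: "'a::euclidean_space \<Rightarrow> real"
  assumes K: "compact K" "K \<noteq> {}" "u \<in> USC K" and L: "compact L" "L \<noteq> {}" "v \<in> LSC L"
    and t: "0 < t"
  obtains x y where "x \<in> K" "y \<in> L"
    "\<And>a b. a \<in> K \<Longrightarrow> b \<in> L \<Longrightarrow> u a - t * v b - \<alpha> * (norm (a - b))\<^sup>2 \<le> u x - t * v y - \<alpha> * (norm (x - y))\<^sup>2"
proof -
  let ?f = "\<lambda>(a, b). u a - t * v b - \<alpha> * (norm (a - b))\<^sup>2"
  have "\<exists>p\<in>K \<times> L. \<forall>q\<in>K \<times> L. ?f q \<le> ?f p"
  proof (rule upper_semicontinuous_attains_sup)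
    fix p c assume p: "p \<in> K \<times> L" "?f p < c"
    obtain a b where ab: "p = (a, b)" by (cases p)
    \<comment> \<open>Each of the three terms of \<open>?f\<close> may use up a third of the gap;
      for \<open>v\<close> this means \<open>e / t\<close>, because of the factor
      \<open>t\<close>.\<close>
    define e where "e = (c - ?f p) / 3"
    have e: "0 < e" using p(2) by (simp add: e_def)
    obtain U where U: "open U" "a \<in> U" "\<forall>y\<in>U \<inter> K. u y < u a + e"
      using USC_open_nbhd[OF K(3), of a "u a + e"] p(1) ab e by auto
    obtain V where V: "open V" "b \<in> V" "\<forall>y\<in>V \<inter> L. v b - e / t < v y"
      using LSC_open_nbhd[OF L(3), of b "v b - e / t"] p(1) ab e t by auto
    let ?W = "{q :: 'a \<times> 'a. \<alpha> * (norm (a - b))\<^sup>2 - e < \<alpha> * (norm (fst q - snd q))\<^sup>2}"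
    have W: "open ?W"
      by (intro open_Collect_less continuous_intros)
    have "?f q < c" if q: "q \<in> (U \<times> V) \<inter> ?W \<inter> (K \<times> L)" for q
    proof -
      obtain a' b' where q': "q = (a', b')" by (cases q)
      have "u a' < u a + e" using U(3) q q' by auto
      moreover have "t * v b - e < t * v b'"
      proof -
        have "v b - e / t < v b'" using V(3) q q' by auto
        then show ?thesis using t by (simp add: field_simps)
      qed
      moreover have "\<alpha> * (norm (a - b))\<^sup>2 - e < \<alpha> * (norm (a' - b'))\<^sup>2" using q q' by auto
      ultimately show ?thesis
        using q' ab by (simp add: e_def field_simps)
    qed
    moreover have "open ((U \<times> V) \<inter> ?W)" "p \<in> (U \<times> V) \<inter> ?W"
      using U V W ab e by (auto intro: open_Int open_Times)
    ultimately show "\<exists>U. open U \<and> p \<in> U \<and> (\<forall>y\<in>U \<inter> (K \<times> L). ?f y < c)"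
      by blast
  qed (use K L in \<open>auto intro: compact_Times\<close>)
  then show ?thesis using that by auto
qed

text \<open>A number strictly between \<open>u z\<close> and \<open>r * v z\<close> separates
  \<open>u\<close> from \<open>r * v\<close> on a whole ball around \<open>z\<close>, by
  semicontinuity. Compactness makes the radius uniform.\<close>

lemma strict_ratio_near_diagonal:
  fixes u v :: "'a::euclidean_space \<Rightarrow> real"
  assumes K: "compact K" "K \<subseteq> \<Omega>" "u \<in> USC K" and \<Omega>: "open \<Omega>" "v \<in> LSC \<Omega>" and r: "0 < r"
    and less: "\<And>x. x \<in> K \<Longrightarrow> u x < r * v x"
  obtains d where "0 < d" "\<And>x y. x \<in> K \<Longrightarrow> dist x y < d \<Longrightarrow> u x < r * v y"
proof -
  have "\<exists>e>0. \<forall>x\<in>K. \<forall>y. dist z x < e \<and> dist z y < e \<longrightarrow> u x < r * v y" if z: "z \<in> K" for z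
  proof -
    obtain m where m: "u z < m" "m < r * v z" using less[OF z] dense by blast
    obtain U where U: "open U" "z \<in> U" "\<forall>x\<in>U \<inter> K. u x < m"
      using USC_open_nbhd[OF K(3) z m(1)] by blast
    obtain V where V: "open V" "z \<in> V" "\<forall>y\<in>V \<inter> \<Omega>. m / r < v y"
      using LSC_open_nbhd[OF \<Omega>(2), of z "m / r"] z K(2) m(2) r by (auto simp: field_simps)
    have "open (U \<inter> V \<inter> \<Omega>)" "z \<in> U \<inter> V \<inter> \<Omega>" using U V \<Omega> z K(2) by auto
    then obtain e where e: "e > 0" "ball z e \<subseteq> U \<inter> V \<inter> \<Omega>"
      using openE by blast
    have "u x < r * v y" if "x \<in> K" "dist z x < e" "dist z y < e" for x y
    proof -
      have "x \<in> ball z e" "y \<in> ball z e" using that by auto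
      then have "x \<in> U \<inter> K" "y \<in> V \<inter> \<Omega>" using e(2) that(1) by auto
      then have "u x < m" "m / r < v y" using U(3) V(3) by blast+
      then show ?thesis using r by (simp add: field_simps)
    qed
    with e show ?thesis by blast
  qed
  then obtain e where e: "\<And>z. z \<in> K \<Longrightarrow> e z > 0"
    "\<And>z x y. z \<in> K \<Longrightarrow> x \<in> K \<Longrightarrow> dist z x < e z \<Longrightarrow> dist z y < e z \<Longrightarrow> u x < r * v y"
    by metis
  have "K \<subseteq> \<Union>((\<lambda>z. ball z (e z)) ` K)" using e(1) by force
  \<comment> \<open>\<open>d\<close> is a Lebesgue number of the cover, so \<open>x\<close> and a
    nearby \<open>y\<close> share one of its balls.\<close>
  then obtain d where d: "0 < d" "\<forall>x\<in>K. \<exists>G\<in>(\<lambda>z. ball z (e z)) ` K. ball x d \<subseteq> G"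
  proof (rule Heine_Borel_lemma[OF K(1)])
    show "open G" if "G \<in> (\<lambda>z. ball z (e z)) ` K" for G using that by auto
  qed blast
  show ?thesis
  proof (rule that[OF d(1)])
    fix x y assume "x \<in> K" "dist x y < d"
    then obtain z where "z \<in> K" "ball x d \<subseteq> ball z (e z)" using d(2) by blast
    moreover have "x \<in> ball x d" "y \<in> ball x d" using d(1) \<open>dist x y < d\<close> by auto
    ultimately have "x \<in> ball z (e z)" "y \<in> ball z (e z)" by blast+
    then have "dist z x < e z" "dist z y < e z" by simp_all
    then show "u x < r * v y" using e(2) \<open>x \<in> K\<close> \<open>z \<in> K\<close> by blast
  qed
qed

lemma USC_subset: "u \<in> USC S \<Longrightarrow> T \<subseteq> S \<Longrightarrow> u \<in> USC T"
  unfolding USC_def using at_le filter_leD by blast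

lemma LSC_subset: "u \<in> LSC S \<Longrightarrow> T \<subseteq> S \<Longrightarrow> u \<in> LSC T"
  unfolding LSC_def using at_le filter_leD by blast

text \<open>Semicontinuity is available only relative to \<open>closure \<Omega>\<close>. Since
  \<open>u\<close> stays below \<open>m\<close> off \<open>\<Omega>\<close>, the superlevel set lies
  in \<open>\<Omega>\<close> and neighbourhoods in the full space can still be found.\<close>

lemma compact_USC_superlevel:
  fixes u :: "'a::euclidean_space \<Rightarrow> real"
  assumes "bounded \<Omega>" "u \<in> USC (closure \<Omega>)" "\<And>x. x \<notin> \<Omega> \<Longrightarrow> u x < m"
  shows "compact {x. m \<le> u x}"
proof -
  have "closed {x. m \<le> u x}"
    unfolding closed_def
  proof (subst open_subopen, intro ballI)
    fix x assume x: "x \<in> - {x. m \<le> u x}"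
    show "\<exists>T. open T \<and> x \<in> T \<and> T \<subseteq> - {x. m \<le> u x}"
    proof (cases "x \<in> closure \<Omega>")
      case True
      then obtain U where "open U" "x \<in> U" "\<forall>y\<in>U \<inter> closure \<Omega>. u y < m"
        using USC_open_nbhd[OF assms(2), of x m] x by auto
      moreover have "u y < m" if "y \<in> U" for y
        using calculation(3) assms(3)[of y] that closure_subset by (cases "y \<in> \<Omega>") auto
      then have "U \<subseteq> - {x. m \<le> u x}" by force
      ultimately show ?thesis by blast
    next
      case False
      moreover have "u y < m" if "y \<notin> closure \<Omega>" for y
        using assms(3) that closure_subset by blast
      then have "- closure \<Omega> \<subseteq> - {x. m \<le> u x}" by force
      ultimately show ?thesis by (intro exI[of _ "- closure \<Omega>"]) auto
    qed
  qed
  moreover have "{x. m \<le> u x} \<subseteq> \<Omega>" using assms(3) by force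
  ultimately show ?thesis
    using assms(1) bounded_subset compact_eq_bounded_closed by blast
qed

text \<open>The maximum is taken over a compact product \<open>K \<times> L\<close> inside
  \<open>\<Omega> \<times> \<Omega>\<close>, where both functions are semicontinuous. It is global
  because the doubled function is at most \<open>m\<close> elsewhere.\<close>

lemma doubling_of_variables:
  fixes u v :: "'a::euclidean_space \<Rightarrow> real"
  assumes \<Omega>: "open \<Omega>" "bounded \<Omega>"
    and u: "u \<in> USC (closure \<Omega>)" "bounded (range u)" "\<And>x. x \<notin> \<Omega> \<Longrightarrow> u x \<le> 0"
    and v: "v \<in> LSC \<Omega>" "\<And>x. 0 \<le> v x"
    and t: "0 < t" "t < r" and x\<^sub>0: "t * v x\<^sub>0 < u x\<^sub>0"
    and less: "\<And>x. x \<in> \<Omega> \<Longrightarrow> u x < r * v x"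
  obtains x y \<alpha> where "x \<in> \<Omega>" "y \<in> \<Omega>" "t * v y < u x" "u x < r * v y"
    "\<And>a b. u a - t * v b - \<alpha> * (norm (a - b))\<^sup>2 \<le> u x - t * v y - \<alpha> * (norm (x - y))\<^sup>2"
proof -
  \<comment> \<open>The value of the doubled function at the diagonal point
    \<open>(x\<^sub>0, x\<^sub>0)\<close>, where the penalty vanishes.\<close>
  define m where "m = u x\<^sub>0 - t * v x\<^sub>0"
  have m: "0 < m" using x\<^sub>0 by (simp add: m_def)
  define K where "K = {x. m \<le> u x}"
  have K\<Omega>: "K \<subseteq> \<Omega>" using u(3) m by (force simp: K_def)
  have K: "compact K" unfolding K_def
    using u(3) m by (intro compact_USC_superlevel[OF \<Omega>(2) u(1)]) force
  have x\<^sub>0K: "x\<^sub>0 \<in> K" using v(2)[of x\<^sub>0] t(1) by (simp add: K_def m_def)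
  have uK: "u \<in> USC K" using USC_subset[OF u(1)] K\<Omega> closure_subset by blast
  obtain d\<^sub>1 where d\<^sub>1: "0 < d\<^sub>1" "\<And>x y. x \<in> K \<Longrightarrow> dist x y < d\<^sub>1 \<Longrightarrow> u x < r * v y"
  proof (rule strict_ratio_near_diagonal[OF K K\<Omega> uK \<Omega>(1) v(1)])
    show "0 < r" using t by simp
    show "u x < r * v x" if "x \<in> K" for x using less K\<Omega> that by blast
  qed blast
  obtain d\<^sub>2 where d\<^sub>2: "0 < d\<^sub>2" "{x. infdist x K \<le> d\<^sub>2} \<subseteq> \<Omega>"
    using compact_in_open_separated[OF _ K \<Omega>(1) K\<Omega>] x\<^sub>0K by auto
  \<comment> \<open>The second point needs room around \<open>K\<close>: a point outside
    \<open>L\<close> is farther than \<open>d\<^sub>2\<close> from every point of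
    \<open>K\<close>.\<close>
  define L where "L = {x. infdist x K \<le> d\<^sub>2}"
  have L: "compact L" unfolding L_def using compact_infdist_le[OF _ K d\<^sub>2(1)] x\<^sub>0K by auto
  have x\<^sub>0L: "x\<^sub>0 \<in> L" using x\<^sub>0K d\<^sub>2(1) by (simp add: L_def)
  have vL: "v \<in> LSC L" using LSC_subset[OF v(1)] d\<^sub>2(2) by (simp add: L_def)
  define d where "d = min d\<^sub>1 d\<^sub>2"
  have d: "0 < d" using d\<^sub>1 d\<^sub>2 by (simp add: d_def)
  obtain B where B: "\<And>x. u x \<le> B" "0 < B"
    using u(2) unfolding bounded_pos by (metis abs_le_D1 rangeI real_norm_def)
  \<comment> \<open>At distance \<open>d\<close> the penalty already equals the upper bound
    \<open>B\<close> of \<open>u\<close>, so a positive value forces the two points to be closer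
    than \<open>d\<close>.\<close>
  define \<alpha> where "\<alpha> = B / d\<^sup>2"
  have \<alpha>: "0 < \<alpha>" "\<alpha> * d\<^sup>2 = B" using B d by (simp_all add: \<alpha>_def)
  have far: "u a - t * v b - \<alpha> * (norm (a - b))\<^sup>2 \<le> 0" if "d \<le> dist a b" for a b
  proof -
    have "d\<^sup>2 \<le> (norm (a - b))\<^sup>2"
      using that d by (intro power_mono) (auto simp: dist_norm)
    then have "B \<le> \<alpha> * (norm (a - b))\<^sup>2" using \<alpha> mult_left_mono by force
    then show ?thesis using B(1)[of a] v(2)[of b] t(1) by (smt (verit) mult_nonneg_nonneg)
  qed
  obtain x y where xy: "x \<in> K" "y \<in> L" and max:
    "\<And>a b. a \<in> K \<Longrightarrow> b \<in> L \<Longrightarrow> u a - t * v b - \<alpha> * (norm (a - b))\<^sup>2 \<le> u x - t * v y - \<alpha> * (norm (x - y))\<^sup>2"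
    using doubled_function_attains_sup[OF K _ uK L _ vL t(1), of \<alpha>] x\<^sub>0K x\<^sub>0L by blast
  let ?M = "u x - t * v y - \<alpha> * (norm (x - y))\<^sup>2"
  have M: "m \<le> ?M" using max[OF x\<^sub>0K x\<^sub>0L] by (simp add: m_def)
  have "u a - t * v b - \<alpha> * (norm (a - b))\<^sup>2 \<le> ?M" for a b
  proof (cases "a \<in> K \<and> b \<in> L")
    case True
    then show ?thesis using max by blast
  next
    case False
    \<comment> \<open>If \<open>a\<close> is in \<open>K\<close> but \<open>b\<close> is not in
      \<open>L\<close>, the points are far apart and the value is at most 0. If \<open>a\<close> is
      not in \<open>K\<close>, already \<open>u a < m\<close>.\<close>
    have "u a - t * v b - \<alpha> * (norm (a - b))\<^sup>2 \<le> m"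
    proof (cases "a \<in> K")
      case True
      have "d \<le> dist a b"
        using False True infdist_le[OF True, of b] by (auto simp: L_def d_def dist_commute)
      then show ?thesis using far[of a b] m by linarith
    next
      case False
      then show ?thesis using v(2)[of b] t(1) \<alpha>(1) unfolding K_def
        by (smt (verit) mem_Collect_eq mult_nonneg_nonneg zero_le_power2)
    qed
    with M show ?thesis by linarith
  qed
  moreover have "0 \<le> \<alpha> * (norm (x - y))\<^sup>2" using \<alpha>(1) by simp
  then have "t * v y < u x" using M m by linarith
  moreover have "dist x y < d" using far[of x y] M m by force
  then have "u x < r * v y" using d\<^sub>1(2)[OF xy(1)] by (simp add: d_def)
  moreover have "x \<in> \<Omega>" "y \<in> \<Omega>" using xy K\<Omega> d\<^sub>2(2) by (auto simp: L_def)
  ultimately show ?thesis using that by blast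
qed

section \<open>From a supersolution to the maximum principle\<close>

lemma maximum_principle_if_supersol:
  fixes \<Omega> :: "'a::euclidean_space set"
  assumes s: "0 < s" "s < 1" and ext: "ext = Sup \<or> ext = Inf"
    and \<Omega>: "open \<Omega>" "bounded \<Omega>" and less: "\<mu> < \<nu>"
    and v: "visc_supersol ext s k \<nu> \<Omega> v" "(INF x\<in>\<Omega>. v x) > 0" "\<And>x. v x \<ge> 0"
  shows "maximum_principle ext s k \<mu> \<Omega>"
  unfolding maximum_principle_def
proof (intro ballI impI)
  fix u x\<^sub>1
  assume u: "u \<in> USC (closure \<Omega>) \<inter> Linfty"
    and sub: "visc_subsol ext s k \<mu> \<Omega> u \<and> (\<forall>x\<in>- \<Omega>. u x \<le> 0)" and x\<^sub>1: "x\<^sub>1 \<in> \<Omega>"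
  show "u x\<^sub>1 \<le> 0"
  proof (rule ccontr)
    assume "\<not> u x\<^sub>1 \<le> 0"
    then have pos: "0 < u x\<^sub>1" by simp
    define i where "i = (INF x\<in>\<Omega>. v x)"
    have i: "0 < i" using v(2) by (simp add: i_def)
    \<comment> \<open>Nonnegativity of \<open>v\<close> supplies the lower bound that makes the real
      infimum meaningful.\<close>
    have vi: "i \<le> v x" if "x \<in> \<Omega>" for x
      unfolding i_def using v(3) that by (intro cINF_lower bdd_belowI2[of _ 0]) auto
    have bdd_u: "bounded (range u)" using u by (simp add: Linfty_def)
    then obtain B where B: "\<And>x. u x \<le> B" "0 < B"
      unfolding bounded_pos by (metis abs_le_D1 rangeI real_norm_def)
    have "u x / v x \<le> B / i" if "x \<in> \<Omega>" for x
    proof -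
      have "u x / v x \<le> B / v x" using B(1)[of x] v(3)[of x] by (rule divide_right_mono)
      also have "\<dots> \<le> B / i" using vi[OF that] B i by (simp add: frac_le)
      finally show ?thesis .
    qed
    then have bdd: "bdd_above ((\<lambda>x. u x / v x) ` \<Omega>)" by (rule bdd_aboveI2)
    define T where "T = (SUP x\<in>\<Omega>. u x / v x)"
    have T_ge: "u x / v x \<le> T" if "x \<in> \<Omega>" for x
      unfolding T_def using bdd that by (rule cSUP_upper2) simp
    have "0 < u x\<^sub>1 / v x\<^sub>1" using pos vi[OF x\<^sub>1] i by simp
    with T_ge[OF x\<^sub>1] have T: "0 < T" by simp
    \<comment> \<open>For positive \<open>\<mu>\<close> the gap between \<open>\<mu>\<close> and
      \<open>\<nu>\<close> is split geometrically: \<open>t = T * q\<close> and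
      \<open>r = T / q\<close> with \<open>q * q = \<mu> / \<nu>\<close> give equality. Otherwise
      any bracket of \<open>T\<close> will do.\<close>
    obtain t r where tr: "0 < t" "t < T" "T < r" and tr\<mu>: "0 < \<mu> \<Longrightarrow> \<mu> * r \<le> \<nu> * t"
    proof (cases "0 < \<mu>")
      case False
      then show ?thesis using that[of "T / 2" "2 * T"] T by simp
    next
      case True
      define q where "q = sqrt (\<mu> / \<nu>)"
      have q: "0 < q" "q < 1" "q * q = \<mu> / \<nu>" using True less by (simp_all add: q_def)
      show ?thesis
      proof (rule that[of "T * q" "T / q"])
        have "\<mu> = \<nu> * q * q" using q(3) True less by (simp add: mult.assoc)
        then have "\<mu> / q = \<nu> * q" using q(1) by (metis nonzero_mult_div_cancel_right less_irrefl)
        then have "\<mu> * (T / q) = \<nu> * (T * q)" by (metis mult.commute mult.left_commute times_divide_eq_right)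
        then show "\<mu> * (T / q) \<le> \<nu> * (T * q)" by simp
      qed (use q T in \<open>auto simp: field_simps\<close>)
    qed
    obtain x\<^sub>0 where x\<^sub>0: "x\<^sub>0 \<in> \<Omega>" "t < u x\<^sub>0 / v x\<^sub>0"
      using less_cSUP_iff[OF _ bdd, of t] x\<^sub>1 tr(2) unfolding T_def by auto
    have x\<^sub>0_gt: "t * v x\<^sub>0 < u x\<^sub>0"
      using x\<^sub>0 vi[OF x\<^sub>0(1)] i by (simp add: field_simps)
    have r_gt: "u x < r * v x" if "x \<in> \<Omega>" for x
    proof -
      have "u x / v x < r" using T_ge[OF that] tr(3) by simp
      then show ?thesis using vi[OF that] i by (simp add: divide_less_eq)
    qed
    have usc: "u \<in> USC (closure \<Omega>)" and lsc: "v \<in> LSC \<Omega>" and out: "\<And>x. x \<notin> \<Omega> \<Longrightarrow> u x \<le> 0"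
      using u v(1) sub by (auto simp: visc_supersol_def)
    have "t < r" using tr by simp
    then obtain x y \<alpha> where xy: "x \<in> \<Omega>" "y \<in> \<Omega>" "t * v y < u x" "u x < r * v y" and max:
      "\<And>a b. u a - t * v b - \<alpha> * (norm (a - b))\<^sup>2 \<le> u x - t * v y - \<alpha> * (norm (x - y))\<^sup>2"
      using doubling_of_variables[OF \<Omega> usc bdd_u out lsc v(3) tr(1) _ x\<^sub>0_gt r_gt] by blast
    have key: "\<nu> * (t * v y) \<le> \<mu> * u x"
      using touching_inequality[OF s ext tr(1) _ v(1) xy(1,2) max] sub by blast
    have vy: "0 < v y" using vi[OF xy(2)] i by simp
    show False
    \<comment> \<open>The sign of \<open>\<mu>\<close> decides which side of the squeeze bounds
      \<open>\<mu> * u x\<close> from above: \<open>u x < r * v y\<close> if it is positive,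
      \<open>t * v y < u x\<close> if not.\<close>
    proof (cases "0 < \<mu>")
      case True
      then have "\<mu> * u x < \<mu> * (r * v y)" using xy(4) by simp
      also have "\<dots> \<le> \<nu> * (t * v y)"
        using mult_right_mono[OF tr\<mu>[OF True], of "v y"] vy by (simp add: mult.assoc)
      finally show False using key by simp
    next
      case False
      then have "\<mu> * u x \<le> \<mu> * (t * v y)" using xy(3) by (intro mult_left_mono_neg) auto
      also have "\<dots> < \<nu> * (t * v y)" using less vy tr(1) by simp
      finally show False using key by simp
    qed
  qed
qed

theorem theorem6p2:
  fixes \<Omega> :: "'a::euclidean_space set" and s :: real and k :: nat
  assumes "0 < s" and "s < 1"
    and "open \<Omega>" and "connected \<Omega>" and "\<Omega> \<noteq> {}" and "bounded \<Omega>"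
    and "k \<in> {1..DIM('a)}"
  shows "(\<forall>\<mu>::real. ereal \<mu> < mu_bar Sup s k \<Omega> \<longrightarrow> maximum_principle Sup s k \<mu> \<Omega>) \<and>
         (\<forall>\<mu>::real. ereal \<mu> < mu_bar Inf s k \<Omega> \<longrightarrow> maximum_principle Inf s k \<mu> \<Omega>)"
proof -
  have "maximum_principle ext s k \<mu> \<Omega>"
    if ext: "ext = Sup \<or> ext = Inf" and \<mu>: "ereal \<mu> < mu_bar ext s k \<Omega>" for ext \<mu>
  proof -
    \<comment> \<open>Lying strictly below the supremum yields an admissible real
      \<open>\<nu>\<close> above \<open>\<mu>\<close>, also if the supremum is infinite or not
      attained.\<close>
    obtain \<nu> v where "\<mu> < \<nu>" "(INF x\<in>\<Omega>. v x) > 0" "\<And>x. v x \<ge> 0" "visc_supersol ext s k \<nu> \<Omega> v"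
      using \<mu> unfolding mu_bar_def less_Sup_iff by auto
    then show ?thesis
      using maximum_principle_if_supersol[OF assms(1,2) ext assms(3,6)] by blast
  qed
  then show ?thesis by blast
qed

end
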